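(* If a ring extension $R\subset S$ has length 2, then $|\mathrm{Supp}_R(S/R)|\leq 2$.
   Context: Rings are commutative and unital; $R\subset S$ denotes a proper ring extension and $[R,S]$ the set of all $R$-subalgebras of $S$. The length $\ell[R,S]$ is the supremum of the lengths $n$ of chains $R_0\subset R_1\subset\cdots\subset R_n$ of elements of $[R,S]$; the extension has length 2 if $\ell[R,S]=2$. For an $R$-module $E$, $\mathrm{Supp}_R(E)=\{P\in\mathrm{Spec}(R)\mid E_P\neq 0\}$. *)

theory Defs
  imports "HOL-Algebra.Algebra" "HOL-Library.Extended_Nat"
begin

section \<open>Ring extensions and their length\<close>

text \<open>A proper extension of commutative unital rings is a commutative ring \<open>S\<close> together with the
  underlying set \<open>R\<close> of a proper subring; as a ring in its own right, \<open>R\<close> is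
  \<open>S\<lparr>carrier := R\<rparr>\<close>.\<close>

definition ring_extension :: "'a set \<Rightarrow> ('a, 'm) ring_scheme \<Rightarrow> bool" where
  "ring_extension R S \<longleftrightarrow> cring S \<and> subring R S \<and> R \<subset> carrier S"

text \<open>The \<open>R\<close>-subalgebras of \<open>S\<close>, i.e. the subrings of \<open>S\<close> containing \<open>R\<close>.\<close>

definition intermediate_rings :: "'a set \<Rightarrow> ('a, 'm) ring_scheme \<Rightarrow> 'a set set" where
  "intermediate_rings R S = {T. subring T S \<and> R \<subseteq> T}"

text \<open>A chain \<open>C 0 \<subset> C 1 \<subset> \<dots> \<subset> C n\<close> has length \<open>n\<close>; the supremum is taken in \<^typ>\<open>enat\<close>, so that
  it is infinite when the lengths are unbounded.\<close>

definition extension_length :: "'a set \<Rightarrow> ('a, 'm) ring_scheme \<Rightarrow> enat" where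
  "extension_length R S =
     (SUP n \<in> {n. \<exists>C :: nat \<Rightarrow> 'a set.
                   (\<forall>i\<le>n. C i \<in> intermediate_rings R S) \<and> (\<forall>i<n. C i \<subset> C (Suc i))}. enat n)"


section \<open>The module \<open>S/R\<close>\<close>

text \<open>The locale \<^locale>\<open>module\<close> puts no condition on the fields \<^const>\<open>monoid.mult\<close> and
  \<^const>\<open>monoid.one\<close>, which module records inherit from ring records; the quotient and the
  localization below leave them undefined.\<close>

definition quotient_module :: "('a, 'b, 'm) module_scheme \<Rightarrow> 'b set \<Rightarrow> ('a, 'b set) module" where
  "quotient_module M N =
     \<lparr>carrier = a_rcosets\<^bsub>M\<^esub> N, monoid.mult = undefined, monoid.one = undefined,
      ring.zero = N, ring.add = set_add M,
      smult = (\<lambda>r A. \<Union>x\<in>A. N +>\<^bsub>M\<^esub> (r \<odot>\<^bsub>M\<^esub> x))\<rparr>"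

text \<open>\<open>S\<close> as a module over any of its subrings, acting by multiplication.\<close>

definition ring_as_module :: "('a, 'm) ring_scheme \<Rightarrow> ('a, 'a) module" where
  "ring_as_module S =
     \<lparr>carrier = carrier S, monoid.mult = monoid.mult S, monoid.one = monoid.one S,
      ring.zero = ring.zero S, ring.add = ring.add S, smult = monoid.mult S\<rparr>"


section \<open>Localization and support of modules\<close>

text \<open>For a multiplicative subset \<open>U\<close> of \<open>R\<close>, the fractions \<open>m/s\<close> and \<open>n/t\<close> are identified iff
  \<open>u(tm - sn) = 0\<close> for some \<open>u \<in> U\<close>.\<close>

definition fraction_rel ::
  "('a, 'b, 'n) module_scheme \<Rightarrow> 'a set \<Rightarrow> (('b \<times> 'a) \<times> ('b \<times> 'a)) set" where
  "fraction_rel M U =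
     {((m, s), (n, t)). m \<in> carrier M \<and> s \<in> U \<and> n \<in> carrier M \<and> t \<in> U \<and>
        (\<exists>u\<in>U. u \<odot>\<^bsub>M\<^esub> (t \<odot>\<^bsub>M\<^esub> m \<ominus>\<^bsub>M\<^esub> s \<odot>\<^bsub>M\<^esub> n) = \<zero>\<^bsub>M\<^esub>)}"

text \<open>The module of fractions, with its structure of \<open>R\<close>-module; the scalar action of the localized
  ring is not needed to say whether it is zero.\<close>

definition localization ::
  "('a, 'm) ring_scheme \<Rightarrow> ('a, 'b, 'n) module_scheme \<Rightarrow> 'a set \<Rightarrow> ('a, ('b \<times> 'a) set) module" where
  "localization R M U =
     \<lparr>carrier = (carrier M \<times> U) // fraction_rel M U,
      monoid.mult = undefined, monoid.one = undefined,
      ring.zero = fraction_rel M U `` {(\<zero>\<^bsub>M\<^esub>, \<one>\<^bsub>R\<^esub>)},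
      ring.add = (\<lambda>A B. \<Union>(m, s)\<in>A. \<Union>(n, t)\<in>B.
               fraction_rel M U `` {(t \<odot>\<^bsub>M\<^esub> m \<oplus>\<^bsub>M\<^esub> s \<odot>\<^bsub>M\<^esub> n, s \<otimes>\<^bsub>R\<^esub> t)}),
      smult = (\<lambda>r A. \<Union>(m, s)\<in>A. fraction_rel M U `` {(r \<odot>\<^bsub>M\<^esub> m, s)})\<rparr>"

definition localization_at_prime ::
  "('a, 'm) ring_scheme \<Rightarrow> ('a, 'b, 'n) module_scheme \<Rightarrow> 'a set \<Rightarrow> ('a, ('b \<times> 'a) set) module" where
  "localization_at_prime R M P = localization R M (carrier R - P)"

definition Spec :: "('a, 'm) ring_scheme \<Rightarrow> 'a set set" where
  "Spec R = {P. primeideal P R}"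

definition Supp :: "('a, 'm) ring_scheme \<Rightarrow> ('a, 'b, 'n) module_scheme \<Rightarrow> 'a set set" where
  "Supp R E = {P \<in> Spec R.
     carrier (localization_at_prime R E P) \<noteq> {\<zero>\<^bsub>localization_at_prime R E P\<^esub>}}"

end

theory Submission
  imports Defs
begin

text \<open>
  A minimal extension \<open>R \<subset> S\<close> has a crucial maximal ideal (Ferrand and Olivier): the set \<open>M\<close> of
  all \<open>a \<in> R\<close> such that every element of \<open>S/R\<close> is killed by a power of \<open>a\<close>. If \<open>a \<in> R\<close> is not in
  \<open>M\<close>, then \<open>a\<close> acts bijectively on \<open>S/R\<close>, because the subring \<open>R + a S\<close> and the subring of all
  \<open>t\<close> with some \<open>a\<^sup>n t \<in> R\<close> can only be \<open>R\<close> or \<open>S\<close>. If moreover no \<open>\<one> \<ominus> a \<otimes> b\<close> were in \<open>M\<close>, then all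
  of these would act bijectively too; but any \<open>t \<notin> R\<close> satisfies \<open>t \<in> R[a t] = S\<close>, a polynomial
  relation whose linear coefficient is of the form \<open>\<one> \<ominus> a \<otimes> b\<close> and whose higher ones are in \<open>a R\<close>,
  and lowering its degree leads to \<open>(\<one> \<ominus> a \<otimes> b) \<otimes> t \<in> R\<close>, a contradiction.

  An extension of length two splits as \<open>R \<subset> T \<subset> S\<close> into minimal ones, with crucial ideals \<open>M\<close>
  and \<open>N\<close>. A prime \<open>P \<noteq> M\<close> in the support misses some \<open>m \<in> M\<close>; up to powers of \<open>m\<close>, the rings
  \<open>R\<close> and \<open>T\<close> agree, and the maximality of \<open>N\<close> in \<open>T\<close> forces \<open>P = N \<inter> R\<close>.
\<close>

section \<open>Adjoining one element to a subring\<close>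

context cring
begin

text \<open>Elements of \<open>simple_extension K x\<close> are Horner forms. Sums are formed by
  adding the outermost Horner steps; products reduce to scaling by \<open>K\<close> through
  induction on the left factor, and negation is scaling by \<open>\<ominus> \<one>\<close>.\<close>

lemma subring_simple_extension:
  assumes K: "subring K R" and x: "x \<in> carrier R"
  shows "subring (simple_extension K x) R"
proof -
  let ?E = "simple_extension K x"
  note KD = subringE[OF K]
  have KC: "\<And>k. k \<in> K \<Longrightarrow> k \<in> carrier R" using KD(1) by blast
  have EC: "\<And>k. k \<in> ?E \<Longrightarrow> k \<in> carrier R"
    using simple_extension_in_carrier[OF KD(1) x] by blast
  have KE: "\<And>k. k \<in> K \<Longrightarrow> k \<in> ?E" using simple_extension_incl[OF KD(1) x] by blast
  have add: "y \<oplus> z \<in> ?E" if "y \<in> ?E" "z \<in> ?E" for y z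
    using that
  proof (induction arbitrary: z rule: simple_extension.induct)
    case zero
    then show ?case using EC by simp
  next
    case (lin k1 k2)
    from lin.prems show ?case
    proof (cases rule: simple_extension.cases)
      case zero
      then show ?thesis using simple_extension.lin[OF lin.hyps] EC[OF lin.hyps(1)] KC[OF lin.hyps(2)] x
        by simp
    next
      case (lin l1 l2)
      have "k1 \<otimes> x \<oplus> k2 \<oplus> (l1 \<otimes> x \<oplus> l2) = (k1 \<oplus> l1) \<otimes> x \<oplus> (k2 \<oplus> l2)"
        using EC[OF lin(2)] EC[OF \<open>k1 \<in> ?E\<close>] KC[OF lin(3)] KC[OF \<open>k2 \<in> K\<close>] x by algebra
      then show ?thesis
        using lin \<open>k2 \<in> K\<close> simple_extension.lin KD(7)
        by (metis \<open>\<And>z. z \<in> simple_extension K x \<Longrightarrow> k1 \<oplus> z \<in> simple_extension K x\<close>)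
    qed
  qed
  have smult: "k \<otimes> y \<in> ?E" if "y \<in> ?E" "k \<in> K" for k y
    using that
  proof (induction rule: simple_extension.induct)
    case zero
    then show ?case using KC by simp
  next
    case (lin k1 k2)
    have "k \<otimes> (k1 \<otimes> x \<oplus> k2) = k \<otimes> k1 \<otimes> x \<oplus> k \<otimes> k2"
      using EC[OF lin(1)] KC[OF lin(2)] KC[OF lin(4)] x by algebra
    then show ?case using lin KD(6) simple_extension.lin by auto
  qed
  have mult: "y \<otimes> z \<in> ?E" if "y \<in> ?E" "z \<in> ?E" for y z
    using that
  proof (induction rule: simple_extension.induct)
    case zero
    then show ?case using EC by simp
  next
    case (lin k1 k2)
    \<comment> \<open>The summand \<open>\<zero>\<close> turns
      \<open>k1 \<otimes> z \<otimes> x\<close> into a Horner step, so that \<open>lin\<close>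
      applies to the induction hypothesis.\<close>
    have "(k1 \<otimes> x \<oplus> k2) \<otimes> z = (k1 \<otimes> z \<otimes> x \<oplus> \<zero>) \<oplus> k2 \<otimes> z"
      using EC[OF lin(1)] KC[OF lin(2)] EC[OF lin(4)] x by algebra
    then show ?case using lin KD(2) smult add simple_extension.lin by auto
  qed
  have neg: "\<ominus> y \<in> ?E" if "y \<in> ?E" for y
  proof -
    have "\<ominus> y = (\<ominus> \<one>) \<otimes> y" using EC[OF that] by algebra
    then show ?thesis using smult[OF that] KD(3,5) by simp
  qed
  show ?thesis
    by (rule subringI) (use EC KE KD(3) neg mult add in auto)
qed

text \<open>The index counts the generators \<open>\<one>, x, \<dots>\<close>; it is not the highest exponent.\<close>

primrec power_span :: "'a set \<Rightarrow> 'a \<Rightarrow> nat \<Rightarrow> 'a set" where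
  "power_span K x 0 = {\<zero>}"
| "power_span K x (Suc n) = {k \<otimes> x [^] n \<oplus> y | k y. k \<in> K \<and> y \<in> power_span K x n}"

lemma power_spanI:
  "k \<in> K \<Longrightarrow> y \<in> power_span K x n \<Longrightarrow> k \<otimes> x [^] n \<oplus> y \<in> power_span K x (Suc n)"
  by auto

section \<open>Linear operations on the spans of powers\<close>

context
  fixes K x
  assumes K: "subring K R" and x: "x \<in> carrier R"
begin

private lemma KC: "k \<in> K \<Longrightarrow> k \<in> carrier R"
  using subringE(1)[OF K] by blast

lemma power_span_carrier: "y \<in> power_span K x n \<Longrightarrow> y \<in> carrier R"
  using KC x by (induction n arbitrary: y) auto

lemma power_span_mono: "y \<in> power_span K x n \<Longrightarrow> y \<in> power_span K x (Suc n)"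
  using power_spanI[OF subringE(2)[OF K], of y x n] power_span_carrier[of y n] x by simp

lemma power_span_zero: "\<zero> \<in> power_span K x n"
  by (induction n) (use power_span_mono in auto)

lemma power_span_add:
  "y \<in> power_span K x n \<Longrightarrow> z \<in> power_span K x n \<Longrightarrow> y \<oplus> z \<in> power_span K x n"
proof (induction n arbitrary: y z)
  case 0
  then show ?case by simp
next
  case (Suc n)
  then obtain k y' l z' where
    y: "y = k \<otimes> x [^] n \<oplus> y'" "k \<in> K" "y' \<in> power_span K x n" and
    z: "z = l \<otimes> x [^] n \<oplus> z'" "l \<in> K" "z' \<in> power_span K x n" by auto
  have "y \<oplus> z = (k \<oplus> l) \<otimes> x [^] n \<oplus> (y' \<oplus> z')"
    unfolding y(1) z(1)
    using KC[OF y(2)] KC[OF z(2)] power_span_carrier[OF y(3)] power_span_carrier[OF z(3)]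
      nat_pow_closed[OF x, of n] by algebra
  then show ?case
    using power_spanI[OF subringE(7)[OF K y(2) z(2)] Suc.IH[OF y(3) z(3)]] by simp
qed

lemma power_span_smult:
  "y \<in> power_span K x n \<Longrightarrow> k \<in> K \<Longrightarrow> k \<otimes> y \<in> power_span K x n"
proof (induction n arbitrary: y)
  case 0
  then show ?case using KC by simp
next
  case (Suc n)
  then obtain l y' where y: "y = l \<otimes> x [^] n \<oplus> y'" "l \<in> K" "y' \<in> power_span K x n" by auto
  have "k \<otimes> y = (k \<otimes> l) \<otimes> x [^] n \<oplus> k \<otimes> y'"
    unfolding y(1)
    using KC[OF Suc.prems(2)] KC[OF y(2)] power_span_carrier[OF y(3)] nat_pow_closed[OF x, of n]
    by algebra
  then show ?case
    using power_spanI[OF subringE(6)[OF K Suc.prems(2) y(2)] Suc.IH[OF y(3) Suc.prems(2)]] by simp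
qed

lemma power_span_neg: "y \<in> power_span K x n \<Longrightarrow> \<ominus> y \<in> power_span K x n"
  using power_span_smult[of y n "\<ominus> \<one>"] subringE(3,5)[OF K] power_span_carrier[of y n]
  by (simp add: l_minus)

lemma power_span_const: "k \<in> K \<Longrightarrow> k \<in> power_span K x (Suc n)"
proof (induction n)
  case 0
  then show ?case using power_spanI[OF _ power_span_zero[of 0], of k] KC by simp
qed (use power_span_mono in blast)

lemma power_span_mult:
  "y \<in> power_span K x n \<Longrightarrow> y \<otimes> x \<in> power_span K x (Suc n)"
proof (induction n arbitrary: y)
  case 0
  then show ?case using power_span_zero[of 1] x by simp
next
  case (Suc n)
  then obtain l y' where y: "y = l \<otimes> x [^] n \<oplus> y'" "l \<in> K" "y' \<in> power_span K x n" by auto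
  have "y \<otimes> x = l \<otimes> x [^] Suc n \<oplus> y' \<otimes> x"
    unfolding y(1) nat_pow_Suc
    using KC[OF y(2)] power_span_carrier[OF y(3)] x nat_pow_closed[OF x, of n] by algebra
  then show ?case using power_spanI[OF y(2) Suc.IH[OF y(3)]] by simp
qed

lemma power_span_Horner:
  "y \<in> power_span K x n \<Longrightarrow> k \<in> K \<Longrightarrow> y \<otimes> x \<oplus> k \<in> power_span K x (Suc n)"
  using power_span_mult power_span_const power_span_add by blast

text \<open>A monic relation of degree \<open>n\<close> makes the span stable under Horner steps:
  the new top term \<open>l \<otimes> x [^] n\<close> is reduced by the relation.\<close>

lemma simple_extension_subset_power_span:
  assumes "x [^] n \<in> power_span K x n" and "n > 0"
  shows "simple_extension K x \<subseteq> power_span K x n"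
proof
  fix y assume "y \<in> simple_extension K x"
  then show "y \<in> power_span K x n"
  proof (induction rule: simple_extension.induct)
    case zero
    show ?case by (rule power_span_zero)
  next
    case (lin y k)
    then obtain l z where z: "y \<otimes> x \<oplus> k = l \<otimes> x [^] n \<oplus> z" "l \<in> K" "z \<in> power_span K x n"
      using power_span_Horner[of y n k] by auto
    then show ?case using assms(1) power_span_smult power_span_add by auto
  qed
qed

end

text \<open>The factor \<open>c [^] n\<close> supplies \<open>i\<close> copies of \<open>c\<close>
  to each term of degree \<open>i\<close>, and the remaining \<open>n - i\<close> go into its
  coefficient. This serves to turn a relation for \<open>x\<close> with leading coefficient
  \<open>c\<close> into a monic one for \<open>c \<otimes> x\<close>.\<close>

lemma power_span_rescale:
  assumes K: "subring K R" and x: "x \<in> carrier R" and c: "c \<in> K"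
  shows "y \<in> power_span K x (Suc n) \<Longrightarrow> c [^] n \<otimes> y \<in> power_span K (c \<otimes> x) (Suc n)"
proof (induction n arbitrary: y)
  case 0
  have "y \<in> carrier R" using power_span_carrier[OF K x 0] .
  with 0 show ?case by simp
next
  case (Suc n)
  then obtain k y' where
    y: "y = k \<otimes> x [^] Suc n \<oplus> y'" "k \<in> K" "y' \<in> power_span K x (Suc n)"
    using power_span.simps(2) by blast
  have carr: "c \<in> carrier R" "k \<in> carrier R" "c \<otimes> x \<in> carrier R"
    using c y(2) x subringE(1)[OF K] by auto
  have "c [^] Suc n \<otimes> y = k \<otimes> (c [^] Suc n \<otimes> x [^] Suc n) \<oplus> c \<otimes> (c [^] n \<otimes> y')"
    unfolding y(1) nat_pow_Suc
    using carr power_span_carrier[OF K x y(3)] x nat_pow_closed[OF x, of n]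
      nat_pow_closed[OF carr(1), of n] by algebra
  also have "c [^] Suc n \<otimes> x [^] Suc n = (c \<otimes> x) [^] Suc n"
    by (rule nat_pow_distrib[OF carr(1) x, symmetric])
  finally show ?case
    using power_spanI[OF y(2) power_span_smult[OF K carr(3) Suc.IH[OF y(3)] c]] by simp
qed

end

section \<open>Minimal extensions\<close>

locale minimal_ring_extension = cring S for S (structure) +
  fixes R
  assumes subring: "subring R S"
    and proper: "R \<noteq> carrier S"
    and minimal: "\<And>T. subring T S \<Longrightarrow> R \<subseteq> T \<Longrightarrow> T = R \<or> T = carrier S"
begin

section \<open>The crucial ideal and multiplication by elements outside it\<close>

definition crucial_ideal where
  "crucial_ideal = {a \<in> R. \<forall>t\<in>carrier S. \<exists>n::nat. a [^] n \<otimes> t \<in> R}"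

lemmas R_closed = subringE(2,3,5-7)[OF subring]

lemma R_carrier: "r \<in> R \<Longrightarrow> r \<in> carrier S"
  using subringE(1)[OF subring] by blast

lemma R_diff: "r \<in> R \<Longrightarrow> s \<in> R \<Longrightarrow> r \<ominus> s \<in> R"
  using R_closed unfolding minus_eq by simp

lemma R_pow: "r \<in> R \<Longrightarrow> r [^] (n::nat) \<in> R"
  by (induction n) (use R_closed in auto)

lemma simple_extension_eq_carrier:
  assumes "t \<in> carrier S" and "t \<notin> R"
  shows "simple_extension R t = carrier S"
  using minimal[OF subring_simple_extension[OF subring assms(1)]]
    simple_extension_incl[OF subringE(1)[OF subring] assms(1)]
    simple_extension_mem[OF subring assms(1)] assms(2) by blast

text \<open>Injectivity of \<open>a\<close> on S/R. The elements that some power of \<open>a\<close>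
  sends into \<open>R\<close> form an intermediate ring, which differs from \<open>S\<close> because
  \<open>a\<close> is outside the crucial ideal; by minimality it is \<open>R\<close>.\<close>

lemma mult_mem_imp_mem:
  assumes a: "a \<in> R" "a \<notin> crucial_ideal" and t: "t \<in> carrier S" "a \<otimes> t \<in> R"
  shows "t \<in> R"
proof -
  let ?T = "{t \<in> carrier S. \<exists>n::nat. a [^] n \<otimes> t \<in> R}"
  have ac: "a \<in> carrier S" by (rule R_carrier[OF a(1)])
  have sub: "R \<subseteq> ?T"
  proof
    fix r assume "r \<in> R"
    moreover from this have "a [^] (0::nat) \<otimes> r \<in> R" using R_carrier by simp
    ultimately show "r \<in> ?T" using R_carrier by blast
  qed
  have "subring ?T S"
  proof (rule subringI)
    show "\<one> \<in> ?T" using sub R_closed(2) by blast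
  next
    fix h assume "h \<in> ?T"
    then obtain n :: nat where n: "h \<in> carrier S" "a [^] n \<otimes> h \<in> R" by blast
    have "a [^] n \<otimes> (\<ominus> h) = \<ominus> (a [^] n \<otimes> h)" using n(1) ac by (simp add: r_minus)
    then show "\<ominus> h \<in> ?T" using n R_closed(3) a_inv_closed by (auto intro: exI[of _ n])
  next
    fix h k assume "h \<in> ?T" "k \<in> ?T"
    then obtain n m :: nat where
      n: "h \<in> carrier S" "a [^] n \<otimes> h \<in> R" and m: "k \<in> carrier S" "a [^] m \<otimes> k \<in> R" by blast
    have pc: "a [^] n \<in> carrier S" "a [^] m \<in> carrier S" using ac by simp_all
    have "a [^] (n + m) \<otimes> (h \<otimes> k) = (a [^] n \<otimes> h) \<otimes> (a [^] m \<otimes> k)"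
      unfolding nat_pow_mult[OF ac, symmetric] using n(1) m(1) pc by algebra
    then have "a [^] (n + m) \<otimes> (h \<otimes> k) \<in> R" using R_closed(4) n(2) m(2) by simp
    then show "h \<otimes> k \<in> ?T" using n(1) m(1) by blast
    have "a [^] (n + m) \<otimes> (h \<oplus> k) = a [^] m \<otimes> (a [^] n \<otimes> h) \<oplus> a [^] n \<otimes> (a [^] m \<otimes> k)"
      unfolding nat_pow_mult[OF ac, symmetric] using n(1) m(1) pc by algebra
    then have "a [^] (n + m) \<otimes> (h \<oplus> k) \<in> R" using R_closed(4,5) R_pow[OF a(1)] n(2) m(2) by simp
    then show "h \<oplus> k \<in> ?T" using n(1) m(1) by blast
  qed auto
  moreover have "?T \<noteq> carrier S" using a unfolding crucial_ideal_def by blast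
  ultimately have "?T = R" using minimal sub by blast
  moreover have "a [^] (1::nat) \<otimes> t \<in> R" using t(2) ac by simp
  ultimately show ?thesis using t(1) by blast
qed

text \<open>Surjectivity of \<open>a\<close> on S/R. The intermediate ring R + aS cannot be
  \<open>R\<close>: otherwise aS would lie in \<open>R\<close>, and injectivity would give S =
  R.\<close>

lemma mult_surj_mod:
  assumes a: "a \<in> R" "a \<notin> crucial_ideal" and t: "t \<in> carrier S"
  obtains r v where "r \<in> R" "v \<in> carrier S" "t = r \<oplus> a \<otimes> v"
proof -
  let ?T = "{r \<oplus> a \<otimes> v | r v. r \<in> R \<and> v \<in> carrier S}"
  have ac: "a \<in> carrier S" by (rule R_carrier[OF a(1)])
  have memI: "r \<oplus> a \<otimes> v \<in> ?T" if "r \<in> R" "v \<in> carrier S" for r v using that by blast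
  have sub: "R \<subseteq> ?T"
  proof
    fix r assume "r \<in> R"
    then show "r \<in> ?T" using memI[of r \<zero>] R_carrier ac by simp
  qed
  have "subring ?T S"
  proof (rule subringI)
    show "?T \<subseteq> carrier S" using R_carrier ac by auto
    show "\<one> \<in> ?T" using sub R_closed(2) by blast
  next
    fix h assume "h \<in> ?T"
    then obtain r v where h: "h = r \<oplus> a \<otimes> v" "r \<in> R" "v \<in> carrier S" by blast
    have "\<ominus> h = \<ominus> r \<oplus> a \<otimes> (\<ominus> v)" unfolding h(1) using h(3) R_carrier[OF h(2)] ac by algebra
    then show "\<ominus> h \<in> ?T" using memI[OF R_closed(3)[OF h(2)] a_inv_closed[OF h(3)]] by simp
  next
    fix h k assume "h \<in> ?T" "k \<in> ?T"
    then obtain r v q w where h: "h = r \<oplus> a \<otimes> v" "r \<in> R" "v \<in> carrier S"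
      and k: "k = q \<oplus> a \<otimes> w" "q \<in> R" "w \<in> carrier S" by blast
    have "h \<otimes> k = r \<otimes> q \<oplus> a \<otimes> (r \<otimes> w \<oplus> q \<otimes> v \<oplus> a \<otimes> v \<otimes> w)"
      unfolding h(1) k(1) using h(3) k(3) R_carrier[OF h(2)] R_carrier[OF k(2)] ac by algebra
    moreover have "r \<otimes> w \<oplus> q \<otimes> v \<oplus> a \<otimes> v \<otimes> w \<in> carrier S"
      using h(3) k(3) R_carrier[OF h(2)] R_carrier[OF k(2)] ac by simp
    ultimately show "h \<otimes> k \<in> ?T" using memI[OF R_closed(4)[OF h(2) k(2)]] by simp
    have "h \<oplus> k = (r \<oplus> q) \<oplus> a \<otimes> (v \<oplus> w)"
      unfolding h(1) k(1) using h(3) k(3) R_carrier[OF h(2)] R_carrier[OF k(2)] ac by algebra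
    then show "h \<oplus> k \<in> ?T" using memI[OF R_closed(5)[OF h(2) k(2)] a_closed[OF h(3) k(3)]] by simp
  qed
  moreover have "?T \<noteq> R"
  proof
    assume eq: "?T = R"
    have "v \<in> R" if v: "v \<in> carrier S" for v
    proof -
      have "\<zero> \<oplus> a \<otimes> v \<in> R" using memI[OF R_closed(1) v] unfolding eq .
      then show ?thesis using mult_mem_imp_mem[OF a v] v ac by simp
    qed
    then show False using proper R_carrier by blast
  qed
  ultimately have "?T = carrier S" using minimal sub by blast
  then show ?thesis using t that by blast
qed

text \<open>The assumptions of this context are contradictory, as its last lemma shows. They make \<open>a\<close> and
  every \<open>\<one> \<ominus> a \<otimes> b\<close> act bijectively on \<open>S/R\<close>.\<close>

context
  fixes a
  assumes a: "a \<in> R" "a \<notin> crucial_ideal"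
    and u: "\<And>b. b \<in> R \<Longrightarrow> \<one> \<ominus> a \<otimes> b \<notin> crucial_ideal"
begin

private lemma ac: "a \<in> carrier S" by (rule R_carrier[OF a(1)])

private lemma u_R: "b \<in> R \<Longrightarrow> \<one> \<ominus> a \<otimes> b \<in> R"
  using R_diff R_closed a by simp

text \<open>Nakayama's lemma: \<open>a\<close> is surjective on \<open>S/R\<close>, which allows to drop generators one by one.\<close>

private lemma power_span_proper:
  assumes s: "s \<in> carrier S"
  shows "power_span R s n \<noteq> carrier S"
proof (induction n)
  case 0
  show ?case using proper R_carrier R_closed(1) by (metis power_span.simps(1) singletonD subsetI subset_antisym)
next
  case (Suc n)
  show ?case
  proof
    assume eq: "power_span R s (Suc n) = carrier S"
    show False
    proof (cases n)
      case 0
      have "v \<in> R" if "v \<in> carrier S" for v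
        using that[folded eq] unfolding 0 using R_carrier by auto
      then show False using proper R_carrier by blast
    next
      case (Suc m)
      \<comment> \<open>This is where n > 0 matters: the span of no generators is only
        \<open>{\<zero>}\<close>.\<close>
      have RV: "r \<in> power_span R s n" if "r \<in> R" for r
        using power_span_const[OF subring s that] unfolding Suc .
      note smult = power_span_smult[OF subring s] and add = power_span_add[OF subring s]
      have pc: "s [^] n \<in> carrier S" using s by simp
      \<comment> \<open>Expanding \<open>y\<close> in the generators and moving its top term to the
        left puts \<open>(\<one> \<ominus> a \<otimes> d) \<otimes> s [^] n\<close> into the span of
        the lower powers.\<close>
      obtain r y where r: "r \<in> R" "y \<in> carrier S" "s [^] n = r \<oplus> a \<otimes> y"
        using mult_surj_mod[OF a pc] by blast
      obtain d z where d: "y = d \<otimes> s [^] n \<oplus> z" "d \<in> R" "z \<in> power_span R s n"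
        using r(2)[folded eq] by auto
      note carr = pc ac R_carrier[OF d(2)] power_span_carrier[OF subring s d(3)] R_carrier[OF r(1)]
      have sn: "s [^] n = r \<oplus> a \<otimes> (d \<otimes> s [^] n \<oplus> z)" using r(3) unfolding d(1) .
      let ?u = "\<one> \<ominus> a \<otimes> d"
      have "?u \<otimes> s [^] n = s [^] n \<ominus> a \<otimes> d \<otimes> s [^] n" using carr by algebra
      also have "\<dots> = r \<oplus> a \<otimes> (d \<otimes> s [^] n \<oplus> z) \<ominus> a \<otimes> d \<otimes> s [^] n"
        by (subst (1) sn) (rule refl)
      also have "\<dots> = r \<oplus> a \<otimes> z" using carr by algebra
      finally have us: "?u \<otimes> s [^] n \<in> power_span R s n"
        using add RV[OF r(1)] smult[OF d(3) a(1)] by simp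
      \<comment> \<open>Since \<open>?u\<close> is surjective on S/R as well, \<open>s [^] n\<close>
        enters only through its multiple by \<open>?u\<close>, which already lies in the smaller
        span.\<close>
      have "carrier S \<subseteq> power_span R s n"
      proof
        fix v assume v: "v \<in> carrier S"
        obtain q w where q: "q \<in> R" "w \<in> carrier S" "v = q \<oplus> ?u \<otimes> w"
          using mult_surj_mod[OF u_R[OF d(2)] u[OF d(2)] v] by blast
        obtain e x where e: "w = e \<otimes> s [^] n \<oplus> x" "e \<in> R" "x \<in> power_span R s n"
          using q(2)[folded eq] by auto
        have "v = q \<oplus> (e \<otimes> (?u \<otimes> s [^] n) \<oplus> ?u \<otimes> x)"
          unfolding q(3) e(1)
          using carr R_carrier[OF q(1)] R_carrier[OF e(2)] power_span_carrier[OF subring s e(3)]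
          by algebra
        then show "v \<in> power_span R s n"
          using add RV[OF q(1)] smult[OF us e(2)] smult[OF e(3) u_R[OF d(2)]] by simp
      qed
      then show False using Suc.IH power_span_carrier[OF subring s] by blast
    qed
  qed
qed

text \<open>The leading term of a shortest relation can be absorbed into the next one: its coefficient
  times \<open>t\<close> is integral over \<open>R\<close>, hence in \<open>R\<close>, as \<open>S\<close> is not a finite \<open>R\<close>-module.\<close>

private lemma no_relation:
  assumes t: "t \<in> carrier S" "t \<notin> R"
  shows "b \<in> R \<Longrightarrow> y \<in> power_span R t n \<Longrightarrow>
    a \<otimes> (t \<otimes> t) \<otimes> y \<oplus> (\<one> \<ominus> a \<otimes> b) \<otimes> t \<notin> R"
proof (induction n arbitrary: b y)
  case 0
  then show ?case
    using mult_mem_imp_mem[OF u_R[OF 0(1)] u[OF 0(1)] t(1)] t ac R_carrier[OF 0(1)] by auto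
next
  case (Suc m)
  show ?case
  proof
    let ?r = "a \<otimes> (t \<otimes> t) \<otimes> y \<oplus> (\<one> \<ominus> a \<otimes> b) \<otimes> t"
    assume rel: "?r \<in> R"
    obtain d z where d: "y = d \<otimes> t [^] m \<oplus> z" "d \<in> R" "z \<in> power_span R t m"
      using Suc.prems(2) by auto
    have tm: "t [^] m \<in> carrier S" using t(1) by simp
    note carr = t(1) ac R_carrier[OF Suc.prems(1)] R_carrier[OF d(2)] tm
      power_span_carrier[OF subring t(1) d(3)]
    let ?c = "a \<otimes> d"
    have c: "?c \<in> R" using R_closed(4) a d by blast
    show False
    proof (cases "?c \<otimes> t \<in> R")
      \<comment> \<open>Cancelling \<open>a\<close> gives \<open>d \<otimes> t \<in> R\<close>, so
        one factor \<open>t\<close> of the leading term can be moved into its coefficient.\<close>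
      case True
      have dt: "d \<otimes> t \<in> R"
        using mult_mem_imp_mem[OF a, of "d \<otimes> t"] True carr by (simp add: m_assoc)
      show False
      proof (cases m)
        \<comment> \<open>The leading term is quadratic in \<open>t\<close> here and merges with the
          linear one, replacing \<open>b\<close> by
          \<open>b \<ominus> d \<otimes> t\<close>.\<close>
        case 0
        have z: "z = \<zero>" using d(3) unfolding 0 by simp
        have "?r = a \<otimes> (t \<otimes> t) \<otimes> \<zero> \<oplus> (\<one> \<ominus> a \<otimes> (b \<ominus> d \<otimes> t)) \<otimes> t"
          unfolding d(1) z unfolding 0 nat_pow_0 using carr by algebra
        moreover have "\<zero> \<in> power_span R t m" by (rule power_span_zero[OF subring t(1)])
        ultimately show False
          using Suc.IH[of "b \<ominus> d \<otimes> t" \<zero>] R_diff[OF Suc.prems(1) dt] rel by simp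
      next
        case (Suc k)
        have tk: "t [^] k \<in> carrier S" using t(1) by simp
        have "?r = a \<otimes> (t \<otimes> t) \<otimes> ((d \<otimes> t) \<otimes> t [^] k \<oplus> z) \<oplus> (\<one> \<ominus> a \<otimes> b) \<otimes> t"
          unfolding d(1) unfolding Suc nat_pow_Suc using carr tk by algebra
        moreover have "(d \<otimes> t) \<otimes> t [^] k \<oplus> z \<in> power_span R t m"
          using power_span_add[OF subring t(1) _ d(3)]
            power_spanI[OF dt power_span_zero[OF subring t(1), of k]]
          unfolding Suc using dt tk R_carrier by simp
        ultimately show False using Suc.IH Suc.prems(1) rel by metis
      qed
    next
      case False
      \<comment> \<open>\<open>?W\<close> is the relation without its leading term and with
        \<open>?r\<close> brought to the same side, in Horner form, so
        \<open>?c \<otimes> t [^] Suc (Suc m)\<close> equals \<open>\<ominus> ?W\<close>.\<close>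
      let ?s = "?c \<otimes> t" and ?W = "(a \<otimes> z \<otimes> t \<oplus> (\<one> \<ominus> a \<otimes> b)) \<otimes> t \<oplus> (\<ominus> ?r)"
      have sc: "?s \<in> carrier S" "?c \<in> carrier S" using carr by simp_all
      have cm: "?c [^] Suc m \<in> carrier S" using sc by blast
      have W: "?W \<in> power_span R t (Suc (Suc m))"
        using power_span_Horner[OF subring t(1)] power_span_smult[OF subring t(1)]
          d(3) a(1) u_R[OF Suc.prems(1)] R_closed(3)[OF rel] by blast
      have "?c \<otimes> t [^] Suc (Suc m) = \<ominus> ?W"
        unfolding d(1) nat_pow_Suc using carr by algebra
      \<comment> \<open>Multiplying by \<open>?c [^] Suc m\<close> makes the relation monic in
        \<open>?s\<close>. Then R[s] = S would lie in a finite span, against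
        \<open>power_span_proper\<close>.\<close>
      moreover have "?s [^] Suc (Suc m) = ?c [^] Suc m \<otimes> (?c \<otimes> t [^] Suc (Suc m))"
        using nat_pow_distrib[OF sc(2) t(1), of "Suc (Suc m)"] sc t(1)
        by (simp add: m_assoc)
      ultimately have "?s [^] Suc (Suc m) = \<ominus> (?c [^] Suc m \<otimes> ?W)"
        using r_minus[OF cm power_span_carrier[OF subring t(1) W]] by simp
      then have "?s [^] Suc (Suc m) \<in> power_span R ?s (Suc (Suc m))"
        using power_span_neg[OF subring sc(1) power_span_rescale[OF subring t(1) c W]] by simp
      then have "simple_extension R ?s \<subseteq> power_span R ?s (Suc (Suc m))"
        by (rule simple_extension_subset_power_span[OF subring sc(1) _ zero_less_Suc])
      then show False
        using simple_extension_eq_carrier[OF sc(1) False] power_span_proper[OF sc(1)]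
          power_span_carrier[OF subring sc(1)] by blast
    qed
  qed
qed

text \<open>Sorts a polynomial in \<open>a \<otimes> t\<close> by powers of \<open>t\<close>, in the
  shape that \<open>no_relation\<close> excludes. In a Horner step the old constant term becomes the
  linear one, and the old linear term joins the part divisible by
  \<open>a \<otimes> (t \<otimes> t)\<close>.\<close>

private lemma simple_extension_mult:
  assumes t: "t \<in> carrier S" and y: "y \<in> simple_extension R (a \<otimes> t)"
  obtains r b w n where "r \<in> R" "b \<in> R" "w \<in> power_span R t n"
    "y = r \<oplus> (a \<otimes> b \<otimes> t \<oplus> a \<otimes> (t \<otimes> t) \<otimes> w)"
proof -
  have "\<exists>r b w n. r \<in> R \<and> b \<in> R \<and> w \<in> power_span R t n \<and>
    y = r \<oplus> (a \<otimes> b \<otimes> t \<oplus> a \<otimes> (t \<otimes> t) \<otimes> w)"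
    using y
  proof (induction rule: simple_extension.induct)
    case zero
    have "\<zero> = \<zero> \<oplus> (a \<otimes> \<zero> \<otimes> t \<oplus> a \<otimes> (t \<otimes> t) \<otimes> \<zero>)" using t ac by algebra
    then show ?case using R_closed(1) power_span_zero[OF subring t] by blast
  next
    case (lin y q)
    then obtain r b w n where *: "r \<in> R" "b \<in> R" "w \<in> power_span R t n"
      "y = r \<oplus> (a \<otimes> b \<otimes> t \<oplus> a \<otimes> (t \<otimes> t) \<otimes> w)" by blast
    have "y \<otimes> (a \<otimes> t) \<oplus> q =
      q \<oplus> (a \<otimes> r \<otimes> t \<oplus> a \<otimes> (t \<otimes> t) \<otimes> (a \<otimes> w \<otimes> t \<oplus> a \<otimes> b))"
      unfolding *(4) using t ac R_carrier[OF *(1)] R_carrier[OF *(2)] R_carrier[OF lin(2)]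
        power_span_carrier[OF subring t *(3)] by algebra
    moreover have "a \<otimes> w \<otimes> t \<oplus> a \<otimes> b \<in> power_span R t (Suc n)"
      using power_span_Horner[OF subring t power_span_smult[OF subring t *(3) a(1)]]
        R_closed(4)[OF a(1) *(2)] by blast
    ultimately show ?case using lin(2) *(1) by blast
  qed
  then show ?thesis using that by blast
qed

text \<open>For \<open>t\<close> outside \<open>R\<close>, injectivity puts
  \<open>a \<otimes> t\<close> outside \<open>R\<close> too, so \<open>t\<close> is a polynomial in
  \<open>a \<otimes> t\<close>. Solved for its constant term, this equation is a relation forbidden
  by \<open>no_relation\<close>.\<close>

lemma not_invertible_mod_crucial_ideal: False
proof -
  obtain t where t: "t \<in> carrier S" "t \<notin> R" using proper R_carrier by blast
  have at: "a \<otimes> t \<in> carrier S" "a \<otimes> t \<notin> R" using t ac mult_mem_imp_mem[OF a] by auto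
  have "t \<in> simple_extension R (a \<otimes> t)" using simple_extension_eq_carrier[OF at] t by simp
  then obtain r b w n where *: "r \<in> R" "b \<in> R" "w \<in> power_span R t n"
    "t = r \<oplus> (a \<otimes> b \<otimes> t \<oplus> a \<otimes> (t \<otimes> t) \<otimes> w)"
    using simple_extension_mult[OF t(1)] by metis
  note carr = t(1) ac R_carrier[OF *(1)] R_carrier[OF *(2)] power_span_carrier[OF subring t(1) *(3)]
  have "a \<otimes> (t \<otimes> t) \<otimes> (\<ominus> w) \<oplus> (\<one> \<ominus> a \<otimes> b) \<otimes> t
    = t \<ominus> (a \<otimes> b \<otimes> t \<oplus> a \<otimes> (t \<otimes> t) \<otimes> w)" using carr by algebra
  also have "\<dots> = r \<oplus> (a \<otimes> b \<otimes> t \<oplus> a \<otimes> (t \<otimes> t) \<otimes> w) \<ominus> (a \<otimes> b \<otimes> t \<oplus> a \<otimes> (t \<otimes> t) \<otimes> w)"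
    using *(4) by simp
  also have "\<dots> = r" using carr by algebra
  finally show False
    using no_relation[OF t *(2) power_span_neg[OF subring t(1) *(3)]] *(1) by simp
qed

end

text \<open>Some \<open>\<one> \<ominus> a \<otimes> b\<close> must be in the crucial ideal, since
  the opposite was just refuted; it serves as \<open>m\<close>.\<close>

lemma crucial_ideal_maximal:
  assumes "a \<in> R" and "a \<notin> crucial_ideal"
  obtains b m where "b \<in> R" "m \<in> crucial_ideal" "a \<otimes> b \<oplus> m = \<one>"
proof -
  obtain b where b: "b \<in> R" "\<one> \<ominus> a \<otimes> b \<in> crucial_ideal"
    using not_invertible_mod_crucial_ideal[OF assms] by blast
  moreover have "a \<otimes> b \<oplus> (\<one> \<ominus> a \<otimes> b) = \<one>"
    using R_carrier[OF assms(1)] R_carrier[OF b(1)] by algebra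
  ultimately show ?thesis using that by blast
qed

end

section \<open>The support of \<open>S/R\<close>\<close>

text \<open>The difference in \<open>fraction_rel\<close> is always an element of \<open>E\<close>,
  hence killed by some \<open>u\<close>. The relation is therefore total and has a single
  class.\<close>

lemma carrier_localization_eq_zero:
  assumes E: "abelian_group E"
    and smult: "\<And>u x. u \<in> U \<Longrightarrow> x \<in> carrier E \<Longrightarrow> u \<odot>\<^bsub>E\<^esub> x \<in> carrier E"
    and one: "\<one>\<^bsub>R\<^esub> \<in> U"
    and ann: "\<And>x. x \<in> carrier E \<Longrightarrow> \<exists>u\<in>U. u \<odot>\<^bsub>E\<^esub> x = \<zero>\<^bsub>E\<^esub>"
  shows "carrier (localization R E U) = {\<zero>\<^bsub>localization R E U\<^esub>}"
proof -
  interpret abelian_group E by (rule E)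
  have "fraction_rel E U = (carrier E \<times> U) \<times> (carrier E \<times> U)"
    unfolding fraction_rel_def using ann smult by auto
  then have "fraction_rel E U `` {p} = carrier E \<times> U" if "p \<in> carrier E \<times> U" for p
    using that by auto
  moreover have "(\<zero>\<^bsub>E\<^esub>, \<one>\<^bsub>R\<^esub>) \<in> carrier E \<times> U" using one by simp
  ultimately show ?thesis
    unfolding localization_def quotient_def by auto
qed

section \<open>Primes in the support and elements of S that witness them\<close>

context
  fixes S :: "('a, 'm) ring_scheme" (structure) and R :: "'a set"
  assumes S: "cring S" and R: "subring R S"
begin

interpretation cring S by (rule S)

private lemma RC: "r \<in> R \<Longrightarrow> r \<in> carrier S"
  using subringE(1)[OF R] by blast

interpretation R: abelian_subgroup R S
  using abelian_subgroupI3[OF additive_subgroupI[OF subring.axioms(1)[OF R]]] abelian_group_axioms .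

private lemma ring_as_module_cosets:
  "a_r_coset (ring_as_module S) = a_r_coset S"
  "A_RCOSETS (ring_as_module S) = A_RCOSETS S"
  "set_add (ring_as_module S) = set_add S"
  by (simp_all add: fun_eq_iff ring_as_module_def a_r_coset_def r_coset_def A_RCOSETS_def RCOSETS_def
      set_add_def set_mult_def)

lemma carrier_quotient_module:
  "carrier (quotient_module (ring_as_module S) R) = (\<lambda>x. R +> x) ` carrier S"
  unfolding quotient_module_def ring_as_module_cosets
  by (auto simp: A_RCOSETS_def RCOSETS_def a_r_coset_def)

text \<open>The union in \<open>quotient_module\<close> runs over all representatives of the coset.
  They differ by elements of \<open>R\<close>, which \<open>r\<close> keeps in \<open>R\<close>, so
  all members of the union coincide.\<close>

lemma smult_quotient_module:
  assumes r: "r \<in> R" and x: "x \<in> carrier S"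
  shows "r \<odot>\<^bsub>quotient_module (ring_as_module S) R\<^esub> (R +> x) = R +> (r \<otimes> x)"
proof -
  have "R +> (r \<otimes> y) = R +> (r \<otimes> x)" if "y \<in> R +> x" for y
  proof -
    obtain q where q: "q \<in> R" "y = q \<oplus> x"
      using \<open>y \<in> R +> x\<close> unfolding a_r_coset_def r_coset_def by auto
    have "r \<otimes> y = r \<otimes> q \<oplus> r \<otimes> x" using q RC r x by (simp add: r_distr)
    then have "r \<otimes> y \<in> R +> (r \<otimes> x)"
      using subringE(6)[OF R r q(1)] RC r x a_rcosI[OF _ subringE(1)[OF R]] by simp
    then show ?thesis
      using a_repr_independence[OF _ _ R.a_subgroup] r x RC by simp
  qed
  moreover have "x \<in> R +> x" by (rule R.a_rcos_self[OF x])
  ultimately have "(\<Union>y\<in>R +> x. R +> (r \<otimes> y)) = R +> (r \<otimes> x)" by blast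
  then show ?thesis
    unfolding quotient_module_def ring_as_module_cosets
    by (simp add: ring_as_module_def)
qed

text \<open>The additive part of the record agrees with the factor group \<open>S A_Mod R\<close>,
  whose laws carry over.\<close>

lemma abelian_group_quotient_module:
  "abelian_group (quotient_module (ring_as_module S) R)"
proof -
  let ?E = "quotient_module (ring_as_module S) R"
  have eq: "carrier ?E = carrier (S A_Mod R)" "ring.add ?E = monoid.mult (S A_Mod R)"
    "ring.zero ?E = monoid.one (S A_Mod R)"
    unfolding quotient_module_def ring_as_module_cosets
    by (simp_all add: A_FactGroup_def FactGroup_def A_RCOSETS_def set_add_def)
  show ?thesis
    by (rule abelian_groupI; unfold eq; rule comm_groupE[OF R.a_factorgroup_is_comm_group]; assumption)
qed

text \<open>If every \<open>s\<close> had a multiplier outside \<open>P\<close> taking it into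
  \<open>R\<close>, each element of S/R would be killed by an element outside \<open>P\<close> and
  the localization would vanish.\<close>

lemma Supp_quotient_moduleE:
  assumes P: "P \<in> Supp (S\<lparr>carrier := R\<rparr>) (quotient_module (ring_as_module S) R)"
  obtains s where "primeideal P (S\<lparr>carrier := R\<rparr>)" and "s \<in> carrier S"
    and "\<And>u. u \<in> R - P \<Longrightarrow> u \<otimes> s \<notin> R"
proof -
  let ?E = "quotient_module (ring_as_module S) R"
  have prime: "primeideal P (S\<lparr>carrier := R\<rparr>)"
    and nz: "carrier (localization (S\<lparr>carrier := R\<rparr>) ?E (R - P)) \<noteq>
      {\<zero>\<^bsub>localization (S\<lparr>carrier := R\<rparr>) ?E (R - P)\<^esub>}"
    using P unfolding Supp_def Spec_def localization_at_prime_def by auto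
  interpret P: primeideal P "S\<lparr>carrier := R\<rparr>" by (rule prime)
  have one: "\<one> \<in> R - P" using P.one_imp_carrier P.I_notcarr subringE(3)[OF R] by auto
  have "\<exists>s\<in>carrier S. \<forall>u\<in>R - P. u \<otimes> s \<notin> R"
  proof (rule ccontr)
    assume "\<not> ?thesis"
    then have ann: "\<exists>u\<in>R - P. u \<otimes> s \<in> R" if "s \<in> carrier S" for s using that by blast
    have zero: "\<zero>\<^bsub>?E\<^esub> = R" unfolding quotient_module_def by simp
    have "carrier (localization (S\<lparr>carrier := R\<rparr>) ?E (R - P)) =
      {\<zero>\<^bsub>localization (S\<lparr>carrier := R\<rparr>) ?E (R - P)\<^esub>}"
    proof (rule carrier_localization_eq_zero[OF abelian_group_quotient_module])
      show "u \<odot>\<^bsub>?E\<^esub> x \<in> carrier ?E" if "u \<in> R - P" "x \<in> carrier ?E" for u x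
        using that smult_quotient_module RC unfolding carrier_quotient_module by auto
      show "\<one>\<^bsub>S\<lparr>carrier := R\<rparr>\<^esub> \<in> R - P" using one by simp
      show "\<exists>u\<in>R - P. u \<odot>\<^bsub>?E\<^esub> x = \<zero>\<^bsub>?E\<^esub>" if x: "x \<in> carrier ?E" for x
      proof -
        obtain s where s: "s \<in> carrier S" "x = R +> s"
          using x unfolding carrier_quotient_module by blast
        obtain u where u: "u \<in> R - P" "u \<otimes> s \<in> R" using ann[OF s(1)] by blast
        then have "u \<odot>\<^bsub>?E\<^esub> x = \<zero>\<^bsub>?E\<^esub>"
          unfolding zero s(2) using smult_quotient_module s(1) RC
            a_coset_join2[OF _ R.a_subgroup] by simp
        then show ?thesis using u(1) by blast
      qed
    qed
    then show False using nz by blast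
  qed
  then show ?thesis using that prime by blast
qed

end

text \<open>The crucial ideal of the upper step lives in \<open>T\<close>, so it is contracted to
  \<open>R\<close> before being compared with \<open>P\<close>. The cases are whether or not
  \<open>P\<close> contains the crucial ideal of the lower step.\<close>

lemma Supp_subset_crucial_ideals:
  fixes S :: "('a, 'm) ring_scheme" (structure)
  assumes RT: "minimal_ring_extension (S\<lparr>carrier := T\<rparr>) R"
    and TS: "minimal_ring_extension S T"
    and R: "subring R S"
  shows "Supp (S\<lparr>carrier := R\<rparr>) (quotient_module (ring_as_module S) R) \<subseteq>
    {minimal_ring_extension.crucial_ideal (S\<lparr>carrier := T\<rparr>) R,
     minimal_ring_extension.crucial_ideal S T \<inter> R}"
proof
  interpret A: minimal_ring_extension "S\<lparr>carrier := T\<rparr>" R by (rule RT)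
  interpret B: minimal_ring_extension S T by (rule TS)
  let ?M = A.crucial_ideal and ?N = B.crucial_ideal
  have pow_eq: "x [^]\<^bsub>S\<lparr>carrier := T\<rparr>\<^esub> n = x [^] n" for x and n :: nat
    by (simp add: nat_pow_def)
  have RT: "r \<in> T" if "r \<in> R" for r using A.R_carrier[OF that] by simp
  have RS: "r \<in> carrier S" if "r \<in> R" for r using B.R_carrier[OF RT[OF that]] .
  note RD = subringE[OF R]
  fix P assume "P \<in> Supp (S\<lparr>carrier := R\<rparr>) (quotient_module (ring_as_module S) R)"
  then obtain s where P: "primeideal P (S\<lparr>carrier := R\<rparr>)" and s: "s \<in> carrier S"
    and sP: "\<And>u. u \<in> R - P \<Longrightarrow> u \<otimes> s \<notin> R"
    using Supp_quotient_moduleE[OF B.is_cring R] by blast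
  interpret P: primeideal P "S\<lparr>carrier := R\<rparr>" by (rule P)
  have one: "\<one> \<in> R - P" using P.one_imp_carrier P.I_notcarr RD(3) by auto
  have PR: "p \<in> R" if "p \<in> P" for p using P.a_subset that by auto
  have P_mult: "p \<otimes> r \<in> P" if "p \<in> P" "r \<in> R" for p r using P.I_r_closed[of p r] that by simp
  have P_add: "p \<oplus> q \<in> P" if "p \<in> P" "q \<in> P" for p q using additive_subgroup.a_closed[OF P.is_additive_subgroup, of p q] that by simp
  have mult: "u \<otimes> v \<in> R - P" if "u \<in> R - P" "v \<in> R - P" for u v
    using P.I_prime[of u v] that RD(6) by auto
  have pow: "u [^] n \<in> R - P" if "u \<in> R - P" for u and n :: nat
    by (induction n) (use one mult[OF _ that] in auto)
  show "P \<in> {?M, ?N \<inter> R}"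
  proof (cases "?M \<subseteq> P")
    case True
    \<comment> \<open>An element of \<open>P\<close> outside \<open>?M\<close> is invertible modulo
      \<open>?M\<close>, which lies in \<open>P\<close>; this would put \<open>\<one>\<close> into
      \<open>P\<close>.\<close>
    have "P \<subseteq> ?M"
    proof
      fix x assume x: "x \<in> P"
      show "x \<in> ?M"
      proof (rule ccontr)
        assume "x \<notin> ?M"
        then obtain b m where "b \<in> R" "m \<in> ?M" "x \<otimes> b \<oplus> m = \<one>"
          using A.crucial_ideal_maximal[OF PR[OF x]] by auto
        then have "\<one> \<in> P" using P_add[OF P_mult[OF x, of b], of m] True by auto
        then show False using one by simp
      qed
    qed
    then show ?thesis using True by simp
  next
    case False
    then obtain m where m: "m \<in> ?M" "m \<notin> P" by blast
    then have mR: "m \<in> R - P" unfolding A.crucial_ideal_def by simp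
    have mT: "\<exists>n::nat. m [^] n \<otimes> t \<in> R" if "t \<in> T" for t
      using m(1) that unfolding A.crucial_ideal_def pow_eq by simp
    \<comment> \<open>A power of \<open>n\<close> moves the witness \<open>s\<close> into
      \<open>T\<close>, and a power of \<open>m\<close> moves it on into \<open>R\<close>. If
      \<open>n\<close> were outside \<open>P\<close>, so would be the product of these powers,
      against the choice of \<open>s\<close>.\<close>
    have NP: "n \<in> P" if n: "n \<in> ?N" "n \<in> R" for n
    proof (rule ccontr)
      assume "n \<notin> P"
      obtain k :: nat where k: "n [^] k \<otimes> s \<in> T"
        using n(1) s unfolding B.crucial_ideal_def by blast
      obtain j :: nat where "m [^] j \<otimes> (n [^] k \<otimes> s) \<in> R" using mT[OF k] by blast
      then have "(m [^] j \<otimes> n [^] k) \<otimes> s \<in> R"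
        using s mR n(2) RS by (simp add: B.m_assoc)
      then show False using sP mult[OF pow[OF mR] pow] n(2) \<open>n \<notin> P\<close> by blast
    qed
    \<comment> \<open>The relation \<open>x \<otimes> y \<oplus> n = \<one>\<close> holds in
      \<open>T\<close>. A power of \<open>m\<close> clears it into \<open>R\<close>, where both
      summands turn out to lie in \<open>P\<close>; this forces that power of \<open>m\<close> into
      \<open>P\<close>.\<close>
    have "x \<in> ?N" if x: "x \<in> P" for x
    proof (rule ccontr)
      assume "x \<notin> ?N"
      then obtain y n where y: "y \<in> T" and n: "n \<in> ?N" and xy: "x \<otimes> y \<oplus> n = \<one>"
        using B.crucial_ideal_maximal[OF RT[OF PR[OF x]]] by metis
      obtain k :: nat where k: "m [^] k \<otimes> y \<in> R" using mT[OF y] by blast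
      have mk: "m [^] k \<in> R" using pow[OF mR] by blast
      have nT: "n \<in> T" using n unfolding B.crucial_ideal_def by simp
      note carr = RS[OF mk] RS[OF PR[OF x]] B.R_carrier[OF y] B.R_carrier[OF nT]
      have eq: "m [^] k = x \<otimes> (m [^] k \<otimes> y) \<oplus> m [^] k \<otimes> n"
      proof -
        have "m [^] k = m [^] k \<otimes> (x \<otimes> y \<oplus> n)" using carr xy by simp
        also have "\<dots> = x \<otimes> (m [^] k \<otimes> y) \<oplus> m [^] k \<otimes> n" using carr by algebra
        finally show ?thesis .
      qed
      have xR: "x \<otimes> (m [^] k \<otimes> y) \<in> R" using RD(6)[OF PR[OF x] k] .
      have "m [^] k \<otimes> n = m [^] k \<oplus> \<ominus> (x \<otimes> (m [^] k \<otimes> y))"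
        using carr by (subst (2) eq) algebra
      then have "m [^] k \<otimes> n \<in> R" using RD(7)[OF mk RD(5)[OF xR]] by simp
      moreover have "m [^] k \<otimes> n \<in> ?N"
      proof -
        have "\<exists>j::nat. (m [^] k \<otimes> n) [^] j \<otimes> t \<in> T" if t: "t \<in> carrier S" for t
        proof -
          obtain j :: nat where j: "n [^] j \<otimes> t \<in> T"
            using n t unfolding B.crucial_ideal_def by blast
          have "(m [^] k \<otimes> n) [^] j \<otimes> t = (m [^] k) [^] j \<otimes> (n [^] j \<otimes> t)"
            using B.nat_pow_distrib[OF carr(1,4)] carr t by (simp add: B.m_assoc)
          then show ?thesis using B.R_closed(4)[OF B.R_pow[OF RT[OF mk]] j] by metis
        qed
        then show ?thesis
          unfolding B.crucial_ideal_def using B.R_closed(4)[OF RT[OF mk] nT] by blast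
      qed
      ultimately have "x \<otimes> (m [^] k \<otimes> y) \<oplus> m [^] k \<otimes> n \<in> P"
        using NP P_add[OF P_mult[OF x k]] by blast
      then have "m [^] k \<in> P" by (subst eq)
      then show False using pow[OF mR] by blast
    qed
    then have "P = ?N \<inter> R" using NP PR by blast
    then show ?thesis by blast
  qed
qed

section \<open>Extensions of length two\<close>

lemma extension_length_ge_3:
  assumes "R0 \<in> intermediate_rings R S" "R1 \<in> intermediate_rings R S"
    "R2 \<in> intermediate_rings R S" "R3 \<in> intermediate_rings R S"
    and "R0 \<subset> R1" "R1 \<subset> R2" "R2 \<subset> R3"
  shows "3 \<le> extension_length R S"
proof -
  let ?C = "\<lambda>i::nat. if i = 0 then R0 else if i = 1 then R1 else if i = 2 then R2 else R3"
  have "\<forall>i<3. ?C i \<subset> ?C (Suc i)"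
    using assms(5-7) by (simp add: numeral_3_eq_3 numeral_2_eq_2 All_less_Suc)
  moreover have "\<forall>i\<le>3. ?C i \<in> intermediate_rings R S" using assms(1-4) by auto
  ultimately have "enat 3 \<le> extension_length R S"
    unfolding extension_length_def by (intro SUP_upper CollectI exI[of _ ?C] conjI)
  then show ?thesis by (simp add: numeral_eq_enat)
qed

text \<open>A chain of length 2 exists and its middle member is \<open>T\<close>. A further ring
  strictly inside either step would yield a chain of length 3.\<close>

lemma length_2_minimal_steps:
  assumes ext: "ring_extension R S" and len: "extension_length R S = 2"
  obtains T where "minimal_ring_extension (S\<lparr>carrier := T\<rparr>) R" "minimal_ring_extension S T"
proof -
  interpret cring S using ext unfolding ring_extension_def by simp
  have R: "subring R S" "R \<subset> carrier S" using ext unfolding ring_extension_def by auto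
  let ?L = "{n. \<exists>C :: nat \<Rightarrow> 'a set.
    (\<forall>i\<le>n. C i \<in> intermediate_rings R S) \<and> (\<forall>i<n. C i \<subset> C (Suc i))}"
  \<comment> \<open>The supremum is attained: otherwise all chain lengths would be at most 1, and so
    would be their supremum.\<close>
  have "2 \<in> ?L"
  proof (rule ccontr)
    assume notin: "2 \<notin> ?L"
    have "n \<le> 1" if "n \<in> ?L" for n
    proof -
      have "enat n \<le> extension_length R S"
        unfolding extension_length_def using that by (rule SUP_upper)
      then have "n \<le> 2" unfolding len numeral_eq_enat by simp
      moreover have "n \<noteq> 2" using that notin by metis
      ultimately show ?thesis by simp
    qed
    then have "extension_length R S \<le> enat 1"
      unfolding extension_length_def by (intro SUP_least) simp
    then show False unfolding len numeral_eq_enat by simp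
  qed
  then obtain C where C: "\<forall>i\<le>2. C i \<in> intermediate_rings R S" "\<forall>i<2::nat. C i \<subset> C (Suc i)"
    by blast
  \<comment> \<open>The chain need not start at \<open>R\<close> or end at \<open>S\<close>, but
    \<open>C 0\<close> contains \<open>R\<close> and \<open>C 2\<close> lies in \<open>S\<close>, so
    \<open>C 1\<close> is strictly between them.\<close>
  define T where "T = C 1"
  have T: "subring T S" "R \<subset> T" "T \<subset> carrier S"
    using C(1)[rule_format, of 0] C(1)[rule_format, of 1] C(1)[rule_format, of 2]
      C(2)[rule_format, of 0] C(2)[rule_format, of 1] subringE(1)[of "C 2" S]
    unfolding T_def intermediate_rings_def by (auto simp: numeral_2_eq_2)
  have no: False if "subring R1 S" "subring R2 S" "R \<subset> R1" "R1 \<subset> R2" "R2 \<subset> carrier S" for R1 R2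
    using extension_length_ge_3[of R R S R1 R2 "carrier S"] that R carrier_is_subring
    unfolding len intermediate_rings_def by auto
  have cT: "cring (S\<lparr>carrier := T\<rparr>)"
    using subcring_iff[OF subringE(1)[OF T(1)]] subcringI'[OF T(1)] by simp
  have sub_iff: "subring U (S\<lparr>carrier := T\<rparr>) \<longleftrightarrow> subring U S \<and> U \<subseteq> T" for U
    using ring.subring_iff[OF cring.axioms(1)[OF cT], of U] subring_iff[of U]
      subringE(1)[of U "S\<lparr>carrier := T\<rparr>"] subringE(1)[OF T(1)] by auto
  have "minimal_ring_extension (S\<lparr>carrier := T\<rparr>) R"
  proof (intro minimal_ring_extension.intro[OF cT] minimal_ring_extension_axioms.intro)
    show "subring R (S\<lparr>carrier := T\<rparr>)" using sub_iff R T by blast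
    show "R \<noteq> carrier (S\<lparr>carrier := T\<rparr>)" using T by auto
    show "U = R \<or> U = carrier (S\<lparr>carrier := T\<rparr>)"
      if "subring U (S\<lparr>carrier := T\<rparr>)" "R \<subseteq> U" for U
      using that no[of U T] T sub_iff by auto
  qed
  moreover have "minimal_ring_extension S T"
  proof (intro minimal_ring_extension.intro[OF is_cring] minimal_ring_extension_axioms.intro)
    show "U = T \<or> U = carrier S" if "subring U S" "T \<subseteq> U" for U
      using that no[of T U] T subringE(1)[of U S] by auto
  qed (use T in auto)
  ultimately show ?thesis using that by blast
qed

theorem proposition2p3:
  fixes S :: "('a, 'm) ring_scheme" and R :: "'a set"
  assumes "ring_extension R S"
    and "extension_length R S = 2"
  shows "finite (Supp (S\<lparr>carrier := R\<rparr>) (quotient_module (ring_as_module S) R)) \<and>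
         card (Supp (S\<lparr>carrier := R\<rparr>) (quotient_module (ring_as_module S) R)) \<le> 2"
proof -
  obtain T where "minimal_ring_extension (S\<lparr>carrier := T\<rparr>) R" "minimal_ring_extension S T"
    using length_2_minimal_steps[OF assms] by blast
  moreover have "subring R S" using assms(1) unfolding ring_extension_def by simp
  ultimately obtain M N where
    sub: "Supp (S\<lparr>carrier := R\<rparr>) (quotient_module (ring_as_module S) R) \<subseteq> {M, N}"
    using Supp_subset_crucial_ideals by metis
  have "card {M, N} \<le> 2" using card_insert_le_m1[of 2 "{N}" M] by simp
  then show ?thesis
    using finite_subset[OF sub] card_mono[OF _ sub] by simp
qed

end
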